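(* Let $w^\star$ be a stable Nash equilibrium of the $h$-player differentiable game $(f_1,\dots,f_h)$. Let $M_i^k\in\mathbb R^{d_i\times d}$, $i=1,\dots,h$, and assume that, for some $\delta>0$, $$\|M_i^k-D(\nabla_{x_i}f_i)(w^\star)\|_2\le\delta,\qquad i=1,\dots,h.$$ Then the approximate antisymmetric correction $\widehat A_k\in\mathbb R^{d\times d}$, defined blockwise by $(\widehat A_k)_{ii}=0$ and $(\widehat A_k)_{ij}=\tfrac12\big([M_i^k]_j-[M_j^k]_i^\top\big)$ for $i\ne j$, satisfies $$\|\widehat A_k-A(w^\star)\|_2\le(h-1)\,\delta.$$
   Context: Game setting. Let $h\ge 2$, $d_1,\dots,d_h\ge1$, $d=\sum_{i=1}^h d_i$. Let $S_i\subset\mathbb R^{d_i}$ be nonempty, convex and compact, and let $\Omega\subset\mathbb R^d$ be open and convex with $S_1\times\cdots\times S_h\subset\Omega$. Player $i$ has objective $f_i\in C^3(\Omega,\mathbb R)$, and $w=(x_1,\dots,x_h)\in\mathbb R^d$ with $x_i\in\mathbb R^{d_i}$. A Nash equilibrium is a point $w^\star=(x_1^\star,\dots,x_h^\star)\in S_1\times\cdots\times S_h$ such that, for every $i$ and every $x_i\in S_i$, $f_i(w^\star)\le f_i(x_1^\star,\dots,x_{i-1}^\star,x_i,x_{i+1}^\star,\dots,x_h^\star)$. The game gradient is $F(w)=(\nabla_{x_1}f_1(w)^\top,\dots,\nabla_{x_h}f_h(w)^\top)^\top$. The game Hessian is $H(w)=DF(w)=(H_{ij}(w))_{i,j=1}^h$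 with $H_{ij}(w)=\nabla^2_{x_ix_j}f_i(w)\in\mathbb R^{d_i\times d_j}$; $S(w)=\tfrac12(H(w)+H(w)^\top)$ and $A(w)=\tfrac12(H(w)-H(w)^\top)$, so that $A(w)$ has blocks $A_{ij}(w)=\tfrac12(H_{ij}(w)-H_{ji}(w)^\top)$, $A_{ii}(w)=0$. $D(\nabla_{x_i}f_i)(w)\in\mathbb R^{d_i\times d}$ is the Jacobian of $\nabla_{x_i}f_i$ with respect to the whole variable $w$, i.e. the block row $(H_{i1}(w),\dots,H_{ih}(w))$. A stable Nash equilibrium $w^\star$ is a Nash equilibrium with $F(w^\star)=0$, $H(w^\star)$ invertible and $S(w^\star)$ positive semidefinite. The matrices $M_i^k$ are written by block columns $M_i^k=([M_i^k]_1,\dots,[M_i^k]_h)$ with $[M_i^k]_j\in\mathbb R^{d_i\times d_j}$. $\|\cdot\|_2$ is the spectral norm. *)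

theory Defs
  imports "HOL-Analysis.Analysis"
begin

text \<open>
  The \<open>h\<close> players are the elements of a finite type \<open>'p\<close>, so \<open>h = CARD('p)\<close>, and the \<open>d\<close>
  coordinates of the joint variable \<open>w = (x\<^sub>1, \<dots>, x\<^sub>h)\<close> are the elements of a finite type \<open>'n\<close>,
  so \<open>d = CARD('n)\<close>.  The function \<open>owner :: 'n \<Rightarrow> 'p\<close> says to which block \<open>x\<^sub>i\<close> a coordinate
  belongs; \<open>d\<^sub>i\<close> is the number of coordinates owned by \<open>i\<close>.  As the \<open>d\<^sub>i\<close> vary with \<open>i\<close>, which a
  family of types cannot do, the space of vectors of length \<open>d\<^sub>i\<close> is identified with the coordinate
  subspace of those vectors of \<open>real ^ 'n\<close> that vanish outside block \<open>i\<close>, and the space of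
  \<open>d\<^sub>i \<times> d\<close> matrices with the \<open>d \<times> d\<close> matrices whose rows outside block \<open>i\<close> vanish.  Both
  identifications are linear isometries, for the Euclidean and the spectral norm respectively.
\<close>

definition block_space :: "('n::finite \<Rightarrow> 'p) \<Rightarrow> 'p \<Rightarrow> (real ^ 'n) set" where
  "block_space owner i = {x. \<forall>k. owner k \<noteq> i \<longrightarrow> x $ k = 0}"

definition block_row_matrices :: "('n::finite \<Rightarrow> 'p) \<Rightarrow> 'p \<Rightarrow> (real ^ 'n ^ 'n) set" where
  "block_row_matrices owner i = {B. \<forall>k. owner k \<noteq> i \<longrightarrow> row k B = 0}"

definition block :: "('n::finite \<Rightarrow> 'p) \<Rightarrow> 'p \<Rightarrow> real ^ 'n \<Rightarrow> real ^ 'n" where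
  "block owner i w = (\<chi> k. if owner k = i then w $ k else 0)"

definition replace_block ::
    "('n::finite \<Rightarrow> 'p) \<Rightarrow> 'p \<Rightarrow> real ^ 'n \<Rightarrow> real ^ 'n \<Rightarrow> real ^ 'n" where
  "replace_block owner i x w = (\<chi> k. if owner k = i then x $ k else w $ k)"

text \<open>\<open>Ck_on n f \<Omega>\<close> is meant for open \<open>\<Omega>\<close> and a finite-dimensional domain.\<close>

fun Ck_on :: "nat \<Rightarrow> ('a::euclidean_space \<Rightarrow> real) \<Rightarrow> 'a set \<Rightarrow> bool" where
  "Ck_on 0 f \<Omega> \<longleftrightarrow> continuous_on \<Omega> f"
| "Ck_on (Suc n) f \<Omega> \<longleftrightarrow>
     (\<forall>w\<in>\<Omega>. f differentiable at w) \<and>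
     (\<forall>v. Ck_on n (\<lambda>w. frechet_derivative f (at w) v) \<Omega>)"

definition gradient :: "(real ^ 'n \<Rightarrow> real) \<Rightarrow> real ^ 'n \<Rightarrow> real ^ 'n::finite" where
  "gradient g w = (\<chi> k. frechet_derivative g (at w) (axis k 1))"

definition partial_gradient ::
    "('n::finite \<Rightarrow> 'p) \<Rightarrow> 'p \<Rightarrow> (real ^ 'n \<Rightarrow> real) \<Rightarrow> real ^ 'n \<Rightarrow> real ^ 'n" where
  "partial_gradient owner i g w = block owner i (gradient g w)"

text \<open>The product of the strategy sets, \<open>S\<^sub>1 \<times> \<dots> \<times> S\<^sub>h\<close>.\<close>

definition profiles :: "('n::finite \<Rightarrow> 'p) \<Rightarrow> ('p \<Rightarrow> (real ^ 'n) set) \<Rightarrow> (real ^ 'n) set" where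
  "profiles owner S = {w. \<forall>i. block owner i w \<in> S i}"

text \<open>Surjectivity of \<open>owner\<close> expresses \<open>d\<^sub>i \<ge> 1\<close> for all \<open>i\<close>.\<close>

definition differentiable_game ::
    "('n::finite \<Rightarrow> 'p::finite) \<Rightarrow> ('p \<Rightarrow> (real ^ 'n) set) \<Rightarrow> (real ^ 'n) set \<Rightarrow>
     ('p \<Rightarrow> real ^ 'n \<Rightarrow> real) \<Rightarrow> bool" where
  "differentiable_game owner S \<Omega> f \<longleftrightarrow>
     CARD('p) \<ge> 2 \<and> surj owner \<and>
     (\<forall>i. S i \<subseteq> block_space owner i \<and> S i \<noteq> {} \<and> convex (S i) \<and> compact (S i)) \<and>
     open \<Omega> \<and> convex \<Omega> \<and> profiles owner S \<subseteq> \<Omega> \<and>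
     (\<forall>i. Ck_on 3 (f i) \<Omega>)"

definition nash_equilibrium ::
    "('n::finite \<Rightarrow> 'p) \<Rightarrow> ('p \<Rightarrow> (real ^ 'n) set) \<Rightarrow> ('p \<Rightarrow> real ^ 'n \<Rightarrow> real) \<Rightarrow> real ^ 'n \<Rightarrow> bool"
  where
  "nash_equilibrium owner S f w \<longleftrightarrow>
     w \<in> profiles owner S \<and> (\<forall>i. \<forall>x\<in>S i. f i w \<le> f i (replace_block owner i x w))"

text \<open>The blocks have disjoint supports, so the sum below is their concatenation.\<close>

definition game_gradient ::
    "('n::finite \<Rightarrow> 'p::finite) \<Rightarrow> ('p \<Rightarrow> real ^ 'n \<Rightarrow> real) \<Rightarrow> real ^ 'n \<Rightarrow> real ^ 'n" where
  "game_gradient owner f w = (\<Sum>i\<in>UNIV. partial_gradient owner i (f i) w)"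

definition game_hessian ::
    "('n::finite \<Rightarrow> 'p::finite) \<Rightarrow> ('p \<Rightarrow> real ^ 'n \<Rightarrow> real) \<Rightarrow> real ^ 'n \<Rightarrow> real ^ 'n ^ 'n" where
  "game_hessian owner f w = jacobian (game_gradient owner f) (at w)"

text \<open>
  The \<open>i\<close>-th block row of the game Hessian is the Jacobian of the \<open>i\<close>-th partial gradient, and its
  entries are the second partial derivatives of \<open>f i\<close>.
\<close>

lemma game_gradient_nth:
  "game_gradient owner f w $ k = frechet_derivative (f (owner k)) (at w) (axis k 1)"
  unfolding game_gradient_def partial_gradient_def block_def gradient_def
  by (simp add: if_distrib cong: if_cong)

lemma partial_gradient_nth:
  "partial_gradient owner i g w $ k =
     (if owner k = i then frechet_derivative g (at w) (axis k 1) else 0)"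
  by (simp add: partial_gradient_def block_def gradient_def)

lemma jacobian_nth:
  fixes F :: "real ^ 'n::finite \<Rightarrow> real ^ 'm::finite"
  assumes "\<And>k. (\<lambda>w. F w $ k) differentiable at w"
  shows "jacobian F (at w) $ k $ l = frechet_derivative (\<lambda>w. F w $ k) (at w) (axis l 1)"
proof -
  have "(F has_derivative (\<lambda>v. \<chi> k. frechet_derivative (\<lambda>w. F w $ k) (at w) v)) (at w)"
    using assms by (subst has_derivative_componentwise_within)
      (auto simp: Basis_vec_def inner_axis frechet_derivative_works)
  then have "frechet_derivative F (at w) = (\<lambda>v. \<chi> k. frechet_derivative (\<lambda>w. F w $ k) (at w) v)"
    using frechet_derivative_at by metis
  then show ?thesis by (simp add: jacobian_def matrix_def)
qed

lemma
  assumes g: "differentiable_game owner S \<Omega> f" and w: "w \<in> \<Omega>"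
  shows game_hessian_row:
      "game_hessian owner f w $ k =
         jacobian (partial_gradient owner (owner k) (f (owner k))) (at w) $ k"
    and game_hessian_nth:
      "game_hessian owner f w $ k $ l =
         frechet_derivative (\<lambda>w. frechet_derivative (f (owner k)) (at w) (axis k 1)) (at w) (axis l 1)"
    and jacobian_partial_gradient_in_block_row_matrices:
      "jacobian (partial_gradient owner i (f i)) (at w) \<in> block_row_matrices owner i"
proof -
  have d: "(\<lambda>w. frechet_derivative (f i) (at w) v) differentiable at w" for i v
    using g w by (simp add: differentiable_game_def numeral_3_eq_3)
  have "(\<lambda>w. game_gradient owner f w $ k) differentiable at w" for k
    using d by (simp add: game_gradient_nth)
  note a = jacobian_nth[OF this]
  have "(\<lambda>w. partial_gradient owner i (f i) w $ k) differentiable at w" for i k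
    using d[of i "axis k 1"] by (cases "owner k = i") (simp_all add: partial_gradient_nth)
  note b = jacobian_nth[OF this]
  show "game_hessian owner f w $ k =
      jacobian (partial_gradient owner (owner k) (f (owner k))) (at w) $ k"
    by (simp add: vec_eq_iff game_hessian_def a b game_gradient_nth partial_gradient_nth)
  show "game_hessian owner f w $ k $ l =
      frechet_derivative (\<lambda>w. frechet_derivative (f (owner k)) (at w) (axis k 1)) (at w) (axis l 1)"
    by (simp add: game_hessian_def a game_gradient_nth)
  show "jacobian (partial_gradient owner i (f i)) (at w) \<in> block_row_matrices owner i"
    by (auto simp add: block_row_matrices_def row_def vec_eq_iff b partial_gradient_nth)
qed

definition sym_part ::
    "('n::finite \<Rightarrow> 'p::finite) \<Rightarrow> ('p \<Rightarrow> real ^ 'n \<Rightarrow> real) \<Rightarrow> real ^ 'n \<Rightarrow> real ^ 'n ^ 'n" where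
  "sym_part owner f w =
     (1/2) *\<^sub>R (game_hessian owner f w + transpose (game_hessian owner f w))"

definition antisym_part ::
    "('n::finite \<Rightarrow> 'p::finite) \<Rightarrow> ('p \<Rightarrow> real ^ 'n \<Rightarrow> real) \<Rightarrow> real ^ 'n \<Rightarrow> real ^ 'n ^ 'n" where
  "antisym_part owner f w =
     (1/2) *\<^sub>R (game_hessian owner f w - transpose (game_hessian owner f w))"

definition positive_semidefinite :: "real ^ 'n ^ 'n::finite \<Rightarrow> bool" where
  "positive_semidefinite B \<longleftrightarrow> transpose B = B \<and> (\<forall>x. 0 \<le> x \<bullet> (B *v x))"

definition stable_nash_equilibrium ::
    "('n::finite \<Rightarrow> 'p::finite) \<Rightarrow> ('p \<Rightarrow> (real ^ 'n) set) \<Rightarrow> ('p \<Rightarrow> real ^ 'n \<Rightarrow> real) \<Rightarrow>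
     real ^ 'n \<Rightarrow> bool" where
  "stable_nash_equilibrium owner S f w \<longleftrightarrow>
     nash_equilibrium owner S f w \<and> game_gradient owner f w = 0 \<and>
     invertible (game_hessian owner f w) \<and> positive_semidefinite (sym_part owner f w)"

definition spectral_norm :: "real ^ 'n::finite ^ 'm::finite \<Rightarrow> real" where
  "spectral_norm B = onorm (\<lambda>x. B *v x)"

text \<open>
  Entry \<open>(k, l)\<close> of the correction lies in block \<open>(i, j) = (owner k, owner l)\<close>, and there
  \<open>[M\<^sub>i]\<^sub>j\<close> has entry \<open>M i $ k $ l\<close> and the transpose of \<open>[M\<^sub>j]\<^sub>i\<close> has entry \<open>M j $ l $ k\<close>.
\<close>

definition antisym_correction ::
    "('n::finite \<Rightarrow> 'p) \<Rightarrow> ('p \<Rightarrow> real ^ 'n ^ 'n) \<Rightarrow> real ^ 'n ^ 'n" where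
  "antisym_correction owner M =
     (\<chi> k l. if owner k = owner l then 0
             else (1/2) * (M (owner k) $ k $ l - M (owner l) $ l $ k))"

end

theory Submission
  imports Defs
begin

text \<open>
  The diagonal blocks of the error vanish because second derivatives are symmetric.  For
  \<open>i \<noteq> j\<close> the block \<open>(i, j)\<close> is half the difference of a block of the \<open>i\<close>-th residual and a
  transposed block of the \<open>j\<close>-th one, so its spectral norm is at most \<open>\<delta>\<close>.  Hence the bilinear form
  of the error is bounded by \<open>\<delta> * (\<Sum>i\<noteq>j. norm y\<^sub>i * norm x\<^sub>j)\<close>, and each \<open>norm y\<^sub>i\<close> and
  \<open>norm x\<^sub>j\<close> occurs in exactly \<open>h - 1\<close> of these products, so that AM-GM gives the factor \<open>h - 1\<close>.
\<close>

section \<open>Symmetry of second derivatives\<close>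

lemma has_real_derivative_along_line:
  fixes f :: "'a::real_normed_vector \<Rightarrow> real"
  assumes "f differentiable at (a + s *\<^sub>R u)"
  shows "((\<lambda>s. f (a + s *\<^sub>R u)) has_real_derivative frechet_derivative f (at (a + s *\<^sub>R u)) u) (at s)"
proof -
  let ?D = "frechet_derivative f (at (a + s *\<^sub>R u))"
  have D: "(f has_derivative ?D) (at (a + s *\<^sub>R u))"
    using assms by (simp add: frechet_derivative_works)
  have "((\<lambda>s. a + s *\<^sub>R u) has_derivative (\<lambda>h. h *\<^sub>R u)) (at s)"
    by (auto intro!: derivative_eq_intros)
  from has_derivative_compose[OF this D]
  have "((\<lambda>s. f (a + s *\<^sub>R u)) has_derivative (\<lambda>h. ?D (h *\<^sub>R u))) (at s)" .
  moreover have "?D (h *\<^sub>R u) = ?D u * h" for h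
    using linear_frechet_derivative[OF assms] by (simp add: linear_cmul)
  ultimately show ?thesis by (simp add: has_field_derivative_def)
qed

text \<open>The mean value theorem is applied twice: along \<open>u\<close> to the difference of the
  two opposite edges of the parallelogram, then along \<open>v\<close> to the derivative in
  direction \<open>u\<close>.\<close>

lemma second_difference_mean_value:
  fixes f :: "'a::real_normed_vector \<Rightarrow> real"
  assumes "t > 0"
    and f: "\<And>a b. \<lbrakk>0 \<le> a; a \<le> t; 0 \<le> b; b \<le> t\<rbrakk> \<Longrightarrow> f differentiable at (w + a *\<^sub>R u + b *\<^sub>R v)"
    and fu: "\<And>a b. \<lbrakk>0 \<le> a; a \<le> t; 0 \<le> b; b \<le> t\<rbrakk> \<Longrightarrow>
       (\<lambda>x. frechet_derivative f (at x) u) differentiable at (w + a *\<^sub>R u + b *\<^sub>R v)"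
  obtains a b where "0 < a" "a < t" "0 < b" "b < t"
    "f (w + t *\<^sub>R u + t *\<^sub>R v) - f (w + t *\<^sub>R u) - f (w + t *\<^sub>R v) + f w =
       t\<^sup>2 * frechet_derivative (\<lambda>x. frechet_derivative f (at x) u) (at (w + a *\<^sub>R u + b *\<^sub>R v)) v"
proof -
  let ?D = "\<lambda>x. frechet_derivative f (at x) u"
  have slice: "((\<lambda>s. f (w + s *\<^sub>R u + b *\<^sub>R v)) has_real_derivative ?D (w + s *\<^sub>R u + b *\<^sub>R v)) (at s)"
    if "0 \<le> s" "s \<le> t" "0 \<le> b" "b \<le> t" for s b
    using has_real_derivative_along_line[of f "w + b *\<^sub>R v" s u] f[OF that] by (simp add: ac_simps)
  \<comment> \<open>The zero multiple of \<open>v\<close> is kept so that both edges are instances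
    of \<open>slice\<close>, with \<open>b = t\<close> and \<open>b = 0\<close>.\<close>
  have line: "((\<lambda>s. f (w + s *\<^sub>R u + t *\<^sub>R v) - f (w + s *\<^sub>R u + 0 *\<^sub>R v)) has_real_derivative
      ?D (w + s *\<^sub>R u + t *\<^sub>R v) - ?D (w + s *\<^sub>R u + 0 *\<^sub>R v)) (at s)" if "0 \<le> s" "s \<le> t" for s
    using that \<open>t > 0\<close> by (intro DERIV_diff slice) simp_all
  obtain a where a: "0 < a" "a < t" and 1:
    "f (w + t *\<^sub>R u + t *\<^sub>R v) - f (w + t *\<^sub>R u + 0 *\<^sub>R v)
       - (f (w + 0 *\<^sub>R u + t *\<^sub>R v) - f (w + 0 *\<^sub>R u + 0 *\<^sub>R v)) =
     (t - 0) * (?D (w + a *\<^sub>R u + t *\<^sub>R v) - ?D (w + a *\<^sub>R u + 0 *\<^sub>R v))"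
    using MVT2[OF \<open>t > 0\<close> line] by blast
  obtain b where b: "0 < b" "b < t" and 2:
    "?D (w + a *\<^sub>R u + t *\<^sub>R v) - ?D (w + a *\<^sub>R u + 0 *\<^sub>R v) =
       (t - 0) * frechet_derivative ?D (at (w + a *\<^sub>R u + b *\<^sub>R v)) v"
    using MVT2[OF \<open>t > 0\<close>, of "\<lambda>s. ?D (w + a *\<^sub>R u + s *\<^sub>R v)"
        "\<lambda>s. frechet_derivative ?D (at (w + a *\<^sub>R u + s *\<^sub>R v)) v"] a
      has_real_derivative_along_line[of ?D "w + a *\<^sub>R u"] fu by auto
  show thesis
    using that[OF a b] 1 2 by (simp add: power2_eq_square algebra_simps)
qed

text \<open>The second difference does not change when \<open>u\<close> and \<open>v\<close> are
  exchanged, so both mixed derivatives take a common value at points arbitrarily close to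
  \<open>w\<close>; continuity carries the equality to \<open>w\<close>.\<close>

lemma second_derivative_symmetric:
  fixes f :: "'a::euclidean_space \<Rightarrow> real"
  assumes f: "Ck_on 2 f \<Omega>" and "open \<Omega>" "w \<in> \<Omega>"
  shows "frechet_derivative (\<lambda>x. frechet_derivative f (at x) u) (at w) v =
         frechet_derivative (\<lambda>x. frechet_derivative f (at x) v) (at w) u"
proof (rule ccontr)
  define D where "D u v = (\<lambda>x. frechet_derivative (\<lambda>x. frechet_derivative f (at x) u) (at x) v)" for u v
  assume "\<not> ?thesis"
  then have e: "dist (D u v w) (D v u w) / 2 > 0" (is "?e > 0")
    by (simp add: D_def)
  have diff: "f differentiable at x" "(\<lambda>x. frechet_derivative f (at x) u) differentiable at x"
    if "x \<in> \<Omega>" for x u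
    using f that by (auto simp: numeral_2_eq_2)
  have "isCont (D u v) w" for u v
    using f \<open>open \<Omega>\<close> \<open>w \<in> \<Omega>\<close>
    by (auto simp: numeral_2_eq_2 D_def continuous_on_eq_continuous_at)
  then have "\<exists>d>0. \<forall>x. dist x w < d \<longrightarrow> dist (D u v x) (D u v w) < ?e" for u v
    using e unfolding continuous_at_eps_delta by blast
  then obtain d1 d2 where d1: "d1 > 0" "\<And>x. dist x w < d1 \<Longrightarrow> dist (D u v x) (D u v w) < ?e"
    and d2: "d2 > 0" "\<And>x. dist x w < d2 \<Longrightarrow> dist (D v u x) (D v u w) < ?e"
    by metis
  obtain d3 where d3: "d3 > 0" "ball w d3 \<subseteq> \<Omega>"
    using \<open>open \<Omega>\<close> \<open>w \<in> \<Omega>\<close> openE by blast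
  define d where "d = min d1 (min d2 d3)"
  \<comment> \<open>The whole parallelogram with sides \<open>t\<close> times \<open>u\<close> and
    \<open>v\<close> must stay within distance \<open>d\<close> of \<open>w\<close>. The summand 1
    keeps the denominator positive when \<open>u = v = 0\<close> and makes the bound strict.\<close>
  define t where "t = d / (norm u + norm v + 1)"
  have pos: "norm u + norm v + 1 > 0" by (simp add: add_nonneg_pos)
  have "d > 0" using d1 d2 d3 by (simp add: d_def)
  with pos have "t > 0" by (simp add: t_def)
  have near: "dist (w + a *\<^sub>R u + b *\<^sub>R v) w < d" if "0 \<le> a" "a \<le> t" "0 \<le> b" "b \<le> t" for a b
  proof -
    have "dist (w + a *\<^sub>R u + b *\<^sub>R v) w = norm (a *\<^sub>R u + b *\<^sub>R v)"
      by (simp add: dist_norm algebra_simps)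
    also have "\<dots> \<le> a * norm u + b * norm v"
      using norm_triangle_ineq[of "a *\<^sub>R u" "b *\<^sub>R v"] that by simp
    also have "\<dots> \<le> t * norm u + t * norm v"
      using that by (intro add_mono mult_right_mono) auto
    also have "\<dots> < t * (norm u + norm v + 1)"
      using \<open>t > 0\<close> by (simp add: algebra_simps)
    also have "\<dots> = d"
      using pos by (simp add: t_def less_imp_neq[THEN not_sym])
    finally show ?thesis .
  qed
  then have in\<Omega>: "w + a *\<^sub>R u + b *\<^sub>R v \<in> \<Omega>" if "0 \<le> a" "a \<le> t" "0 \<le> b" "b \<le> t" for a b
    using that d3 by (auto simp: d_def dist_commute subset_eq)
  obtain a b where ab: "0 < a" "a < t" "0 < b" "b < t"
    "f (w + t *\<^sub>R u + t *\<^sub>R v) - f (w + t *\<^sub>R u) - f (w + t *\<^sub>R v) + f w =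
       t\<^sup>2 * D u v (w + a *\<^sub>R u + b *\<^sub>R v)"
    unfolding D_def
    by (rule second_difference_mean_value[OF \<open>t > 0\<close>, of f w u v]) (simp_all add: diff in\<Omega>)
  have in\<Omega>': "w + b *\<^sub>R v + a *\<^sub>R u \<in> \<Omega>" if "0 \<le> a" "a \<le> t" "0 \<le> b" "b \<le> t" for a b
    using in\<Omega>[OF that] by (simp add: ac_simps)
  \<comment> \<open>The same second difference, now expanded along \<open>v\<close> first.\<close>
  obtain b' a' where ab': "0 < b'" "b' < t" "0 < a'" "a' < t"
    "f (w + t *\<^sub>R v + t *\<^sub>R u) - f (w + t *\<^sub>R v) - f (w + t *\<^sub>R u) + f w =
       t\<^sup>2 * D v u (w + b' *\<^sub>R v + a' *\<^sub>R u)"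
    unfolding D_def
    by (rule second_difference_mean_value[OF \<open>t > 0\<close>, of f w v u]) (simp_all add: diff in\<Omega>')
  have "t\<^sup>2 * D u v (w + a *\<^sub>R u + b *\<^sub>R v) = t\<^sup>2 * D v u (w + a' *\<^sub>R u + b' *\<^sub>R v)"
    using ab(5) ab'(5) by (simp add: algebra_simps)
  then have eq: "D u v (w + a *\<^sub>R u + b *\<^sub>R v) = D v u (w + a' *\<^sub>R u + b' *\<^sub>R v)"
    using \<open>t > 0\<close> by simp
  have "dist (D u v (w + a *\<^sub>R u + b *\<^sub>R v)) (D u v w) < ?e"
    using near[of a b] ab by (intro d1) (auto simp: d_def)
  moreover have "dist (D v u (w + a' *\<^sub>R u + b' *\<^sub>R v)) (D v u w) < ?e"
    using near[of a' b'] ab' by (intro d2) (auto simp: d_def)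
  \<comment> \<open>The common value \<open>eq\<close> is within half the distance of both
    \<open>D u v w\<close> and \<open>D v u w\<close>, which is absurd.\<close>
  ultimately have "dist (D u v w) (D v u w) < dist (D u v w) (D v u w)"
    unfolding eq by (rule dist_triangle_half_r)
  then show False by simp
qed

section \<open>Spectral norm and block bounds\<close>

lemma inner_le_spectral_norm:
  fixes B :: "real ^ 'n::finite ^ 'm::finite"
  shows "y \<bullet> (B *v x) \<le> spectral_norm B * (norm y * norm x)"
proof -
  have "y \<bullet> (B *v x) \<le> norm y * norm (B *v x)"
    by (rule norm_cauchy_schwarz)
  also have "\<dots> \<le> norm y * (spectral_norm B * norm x)"
    unfolding spectral_norm_def
    by (intro mult_left_mono onorm matrix_vector_mul_bounded_linear) simp
  finally show ?thesis by (simp add: ac_simps)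
qed

text \<open>The arithmetic mean in the hypothesis is no weaker than a product of norms, since
  \<open>y\<close> may be rescaled to the length of \<open>x\<close>, where AM-GM is an
  equality.\<close>

lemma spectral_norm_le:
  fixes B :: "real ^ 'n::finite ^ 'm::finite"
  assumes "\<And>x y. y \<bullet> (B *v x) \<le> c * (((norm y)\<^sup>2 + (norm x)\<^sup>2) / 2)"
  shows "spectral_norm B \<le> c"
  unfolding spectral_norm_def
proof (rule onorm_le)
  fix x :: "real ^ 'n"
  show "norm (B *v x) \<le> c * norm x"
  proof (cases "B *v x = 0 \<or> x = 0")
    case True
    \<comment> \<open>The choice \<open>y = 0\<close> gives the sign of \<open>c\<close> when
      \<open>x\<close> is nonzero.\<close>
    have "0 \<le> c * ((norm x)\<^sup>2 / 2)"
      using assms[of 0 x] by simp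
    then have "x = 0 \<or> 0 \<le> c"
      by (auto simp: zero_le_mult_iff)
    with True show ?thesis by auto
  next
    case False
    \<comment> \<open>The test vector is \<open>B *v x\<close> rescaled to the norm of
      \<open>x\<close>: being parallel to \<open>B *v x\<close>, it also attains equality in
      Cauchy-Schwarz.\<close>
    define r where "r = norm x / norm (B *v x)"
    have "norm (r *\<^sub>R (B *v x)) = norm x"
      using False by (simp add: r_def)
    moreover have "(r *\<^sub>R (B *v x)) \<bullet> (B *v x) = norm x * norm (B *v x)"
      using False by (simp add: r_def power2_eq_square flip: power2_norm_eq_inner)
    ultimately have "norm x * norm (B *v x) \<le> norm x * (c * norm x)"
      using assms[of "r *\<^sub>R (B *v x)" x] by (simp add: power2_eq_square mult_ac)
    then show ?thesis
      using False by (simp only: mult_le_cancel_left_pos zero_less_norm_iff simp_thms de_Morgan_disj)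
  qed
qed

lemma sum_block:
  fixes owner :: "'n::finite \<Rightarrow> 'p::finite"
  shows "(\<Sum>i\<in>UNIV. block owner i x) = x"
  by (simp add: vec_eq_iff block_def if_distrib cong: if_cong)

text \<open>Pythagoras: each coordinate has exactly one owner, so the blocks are mutually
  orthogonal.\<close>

lemma sum_norm_block:
  fixes owner :: "'n::finite \<Rightarrow> 'p::finite"
  shows "(\<Sum>i\<in>UNIV. (norm (block owner i x))\<^sup>2) = (norm x)\<^sup>2"
proof -
  have "(\<Sum>i\<in>UNIV. (norm (block owner i x))\<^sup>2) =
      (\<Sum>i\<in>UNIV. \<Sum>k\<in>UNIV. if owner k = i then x $ k * x $ k else 0)"
    unfolding power2_norm_eq_inner inner_vec_def block_def by (intro sum.cong) auto
  also have "\<dots> = (norm x)\<^sup>2"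
    by (subst sum.swap) (simp add: power2_norm_eq_inner inner_vec_def)
  finally show ?thesis .
qed

lemma sum_off_diagonal_le:
  fixes a b :: "'p::finite \<Rightarrow> real"
  shows "(\<Sum>i\<in>UNIV. \<Sum>j\<in>UNIV - {i}. a i * b j) \<le>
    (real CARD('p) - 1) * (((\<Sum>i\<in>UNIV. (a i)\<^sup>2) + (\<Sum>i\<in>UNIV. (b i)\<^sup>2)) / 2)"
proof -
  have card: "real (card (UNIV - {i})) = real CARD('p) - 1" for i :: 'p
    by (simp add: card_Diff_singleton of_nat_diff)
  have "(\<Sum>i\<in>UNIV. \<Sum>j\<in>UNIV - {i}. a i * b j) \<le> (\<Sum>i\<in>UNIV. \<Sum>j\<in>UNIV - {i}. ((a i)\<^sup>2 + (b j)\<^sup>2) / 2)"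
  proof (intro sum_mono)
    show "a i * b j \<le> ((a i)\<^sup>2 + (b j)\<^sup>2) / 2" for i j
      using sum_squares_bound[of "a i" "b j"] by simp
  qed
  \<comment> \<open>For fixed \<open>i\<close>, the square of \<open>a i\<close> occurs once for
    each \<open>j\<close> other than \<open>i\<close>, while the squares of the \<open>b j\<close>
    form the full sum minus its own term; summing over \<open>i\<close> leaves the factor
    \<open>CARD('p) - 1\<close> on both.\<close>
  also have "\<dots> = ((\<Sum>i\<in>UNIV. (real CARD('p) - 1) * (a i)\<^sup>2) +
      (\<Sum>i\<in>UNIV. (\<Sum>j\<in>UNIV. (b j)\<^sup>2) - (b i)\<^sup>2)) / 2"
    by (simp add: sum.distrib card sum_diff1 flip: sum_divide_distrib)
  also have "\<dots> = (real CARD('p) - 1) * (((\<Sum>i\<in>UNIV. (a i)\<^sup>2) + (\<Sum>i\<in>UNIV. (b i)\<^sup>2)) / 2)"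
    by (simp add: sum_subtractf sum_distrib_left[symmetric] algebra_simps)
  finally show ?thesis .
qed

text \<open>Blocks are not separate matrices in this encoding, so the bound on block
  \<open>(i, j)\<close> is stated through the bilinear form restricted to the two block spaces.
  Splitting \<open>x\<close> and \<open>y\<close> into blocks leaves only off-diagonal
  terms.\<close>

lemma spectral_norm_le_of_blocks:
  fixes B :: "real ^ 'n::finite ^ 'n" and owner :: "'n \<Rightarrow> 'p::finite"
  assumes diag: "\<And>k l. owner k = owner l \<Longrightarrow> B $ k $ l = 0"
    and off: "\<And>i j x y. \<lbrakk>i \<noteq> j; x \<in> block_space owner j; y \<in> block_space owner i\<rbrakk> \<Longrightarrow>
      y \<bullet> (B *v x) \<le> c * (norm y * norm x)"
    and "c \<ge> 0"
  shows "spectral_norm B \<le> (real CARD('p) - 1) * c"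
proof (rule spectral_norm_le)
  fix x y :: "real ^ 'n"
  let ?b = "block owner"
  have zero: "?b i y \<bullet> (B *v ?b i x) = 0" for i
    unfolding inner_vec_def matrix_vector_mult_def
    by (intro sum.neutral) (auto simp: block_def diag intro!: sum.neutral)
  have "y \<bullet> (B *v x) = (\<Sum>i\<in>UNIV. ?b i y) \<bullet> (B *v (\<Sum>j\<in>UNIV. ?b j x))"
    by (simp add: sum_block)
  also have "\<dots> = (\<Sum>i\<in>UNIV. \<Sum>j\<in>UNIV. ?b i y \<bullet> (B *v ?b j x))"
    by (simp add: linear_sum[OF matrix_vector_mul_linear] inner_sum_left inner_sum_right)
      (rule sum.swap)
  also have "\<dots> = (\<Sum>i\<in>UNIV. \<Sum>j\<in>UNIV - {i}. ?b i y \<bullet> (B *v ?b j x))"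
    by (simp add: sum_diff1 zero)
  also have "\<dots> \<le> (\<Sum>i\<in>UNIV. \<Sum>j\<in>UNIV - {i}. c * (norm (?b i y) * norm (?b j x)))"
  proof (intro sum_mono)
    fix i j :: 'p assume "j \<in> UNIV - {i}"
    then show "?b i y \<bullet> (B *v ?b j x) \<le> c * (norm (?b i y) * norm (?b j x))"
      by (intro off[of i j]) (auto simp: block_space_def block_def)
  qed
  also have "\<dots> = c * (\<Sum>i\<in>UNIV. \<Sum>j\<in>UNIV - {i}. norm (?b i y) * norm (?b j x))"
    by (simp add: sum_distrib_left)
  also have "\<dots> \<le> c * ((real CARD('p) - 1) * (((norm y)\<^sup>2 + (norm x)\<^sup>2) / 2))"
    using sum_off_diagonal_le[of "\<lambda>i. norm (?b i y)" "\<lambda>j. norm (?b j x)"] \<open>c \<ge> 0\<close>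
    by (intro mult_left_mono) (simp_all add: sum_norm_block)
  finally show "y \<bullet> (B *v x) \<le> (real CARD('p) - 1) * c * (((norm y)\<^sup>2 + (norm x)\<^sup>2) / 2)"
    by (simp add: mult_ac)
qed

section \<open>The antisymmetric correction\<close>

text \<open>Coordinates with the same owner give second derivatives of one and the same objective,
  to which symmetry applies.\<close>

lemma game_hessian_diagonal_block_symmetric:
  assumes g: "differentiable_game owner S \<Omega> f" and w: "w \<in> \<Omega>" and "owner k = owner l"
  shows "game_hessian owner f w $ k $ l = game_hessian owner f w $ l $ k"
proof -
  have "Ck_on 2 (f i) \<Omega>" for i
  proof -
    have "Ck_on 3 (f i) \<Omega>" using g by (simp add: differentiable_game_def)
    \<comment> \<open>At order two, \<open>Ck_on\<close> asks for continuity where order three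
      provides differentiability; this bridges the two.\<close>
    moreover have "continuous_on \<Omega> g" if "\<forall>w\<in>\<Omega>. g differentiable at w" for g :: "real ^ 'a \<Rightarrow> real"
      using that by (intro differentiable_imp_continuous_on)
        (auto simp: differentiable_on_def intro: differentiable_at_withinI)
    ultimately show ?thesis by (simp add: numeral_2_eq_2 numeral_3_eq_3)
  qed
  moreover have "open \<Omega>" using g by (simp add: differentiable_game_def)
  ultimately show ?thesis
    using w \<open>owner k = owner l\<close> second_derivative_symmetric[of "f (owner l)" \<Omega> w]
    by (simp add: game_hessian_nth[OF g w])
qed

theorem lemma1:
  fixes owner :: "'n::finite \<Rightarrow> 'p::finite"
    and S :: "'p \<Rightarrow> (real ^ 'n) set"
    and \<Omega> :: "(real ^ 'n) set"
    and f :: "'p \<Rightarrow> real ^ 'n \<Rightarrow> real"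
    and w :: "real ^ 'n"
    and M :: "'p \<Rightarrow> real ^ 'n ^ 'n"
    and \<delta> :: real
  assumes game: "differentiable_game owner S \<Omega> f"
    and stable: "stable_nash_equilibrium owner S f w"
    and M: "\<And>i. M i \<in> block_row_matrices owner i"
    and \<delta>: "\<delta> > 0"
    and close: "\<And>i. spectral_norm (M i - jacobian (partial_gradient owner i (f i)) (at w)) \<le> \<delta>"
  shows "spectral_norm (antisym_correction owner M - antisym_part owner f w)
           \<le> (real CARD('p) - 1) * \<delta>"
proof (rule spectral_norm_le_of_blocks[where owner = owner])
  have w: "w \<in> \<Omega>"
    using game stable
    by (auto simp: differentiable_game_def stable_nash_equilibrium_def nash_equilibrium_def)
  let ?E = "antisym_correction owner M - antisym_part owner f w"
  define R where "R i = M i - jacobian (partial_gradient owner i (f i)) (at w)" for i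
  show "?E $ k $ l = 0" if "owner k = owner l" for k l
    using game_hessian_diagonal_block_symmetric[of owner S \<Omega> f w k l, OF game w that] that
    by (simp add: antisym_correction_def antisym_part_def transpose_def)
  \<comment> \<open>Row \<open>k\<close> of the Hessian comes from the Jacobian of player
    \<open>owner k\<close>, so the transposed entry involves the residual of player
    \<open>owner l\<close>.\<close>
  have E: "?E $ k $ l = (R (owner k) $ k $ l - R (owner l) $ l $ k) / 2"
    if "owner k \<noteq> owner l" for k l
    using that
    by (simp add: antisym_correction_def antisym_part_def transpose_def R_def
        game_hessian_row[OF game w] field_simps)
  show "y \<bullet> (?E *v x) \<le> \<delta> * (norm y * norm x)"
    if ij: "i \<noteq> j" and x: "x \<in> block_space owner j" and y: "y \<in> block_space owner i" for i j x y
  proof -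
    have form: "z \<bullet> (B *v v) = (\<Sum>k\<in>UNIV. \<Sum>l\<in>UNIV. z $ k * B $ k $ l * v $ l)"
      for z v :: "real ^ 'n" and B :: "real ^ 'n ^ 'n"
      by (simp add: inner_vec_def matrix_vector_mult_def sum_distrib_left mult.assoc)
    \<comment> \<open>Multiplying by the coordinates of \<open>x\<close> and \<open>y\<close> makes
      the formula valid for all \<open>k\<close> and \<open>l\<close>: outside block
      \<open>(i, j)\<close> one of these factors vanishes.\<close>
    have "y $ k * ?E $ k $ l * x $ l =
        (y $ k * R i $ k $ l * x $ l - x $ l * R j $ l $ k * y $ k) / 2" for k l
    proof (cases "owner k = i \<and> owner l = j")
      case True
      with E[of k l] ij have "?E $ k $ l = (R i $ k $ l - R j $ l $ k) / 2" by simp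
      then have "y $ k * ?E $ k $ l * x $ l = y $ k * ((R i $ k $ l - R j $ l $ k) / 2) * x $ l"
        by (simp only:)
      then show ?thesis by (simp only:) (simp add: field_simps)
    next
      case False
      with x y have "y $ k = 0 \<or> x $ l = 0" by (auto simp: block_space_def)
      then show ?thesis by auto
    qed
    then have "y \<bullet> (?E *v x) = (\<Sum>k\<in>UNIV. \<Sum>l\<in>UNIV.
        (y $ k * R i $ k $ l * x $ l - x $ l * R j $ l $ k * y $ k) / 2)"
      unfolding form by (intro sum.cong refl) blast
    also have "\<dots> = (y \<bullet> (R i *v x) -
        (\<Sum>k\<in>UNIV. \<Sum>l\<in>UNIV. x $ l * R j $ l $ k * y $ k)) / 2"
      unfolding form by (simp add: sum_subtractf flip: sum_divide_distrib)
    \<comment> \<open>Exchanging the sums undoes the transposition, so the full residual of player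
      \<open>j\<close> acts on \<open>y\<close> and no norm of a single block is needed.\<close>
    also have "\<dots> = (y \<bullet> (R i *v x) - x \<bullet> (R j *v y)) / 2"
      unfolding form by (subst (2) sum.swap) simp
    \<comment> \<open>\<open>inner_le_spectral_norm\<close> bounds only from above, so the minus
      sign is moved into the vector, whose norm it preserves.\<close>
    also have "\<dots> = (y \<bullet> (R i *v x) + (- x) \<bullet> (R j *v y)) / 2"
      by simp
    also have "\<dots> \<le> (\<delta> * (norm y * norm x) + \<delta> * (norm (- x) * norm y)) / 2"
      using close
      by (intro divide_right_mono add_mono order.trans[OF inner_le_spectral_norm] mult_right_mono)
        (auto simp: R_def)
    finally show ?thesis by (simp add: mult_ac)
  qed
qed (use \<delta> in simp)

end
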